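(* Let $\phi\in\mathbb{R}$ be a rational multiple of $\pi$, and let $\gamma\in\mathbb{R}$ satisfy $\pm\cos\frac{\gamma}{2}=\cos^2\frac{\phi}{2}$ (that is, $\cos\frac{\gamma}{2}=\cos^2\frac{\phi}{2}$ or $-\cos\frac{\gamma}{2}=\cos^2\frac{\phi}{2}$). Then $\gamma$ is a rational multiple of $\pi$ if and only if $\phi\in\{\frac{k\pi}{2}:k\in\mathbb{Z}\}$.
   Context: A real number $\theta$ is a rational multiple of $\pi$ if $\theta=a\pi$ for some $a\in\mathbb{Q}$. *)

theory Defs
  imports Complex_Main
begin

definition rational_multiple_of_pi :: "real \<Rightarrow> bool" where
  "rational_multiple_of_pi \<theta> \<longleftrightarrow> (\<exists>a\<in>\<rat>. \<theta> = a * pi)"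

end

theory Submission
  imports Defs
begin

text \<open>
  Suppose \<open>\<phi>\<close> and \<open>\<gamma>\<close> are rational multiples of \<open>\<pi>\<close> and put \<open>\<zeta> = cis \<phi>\<close>.  Since
  \<open>cos \<phi> = \<plusminus>2 cos (\<gamma>/2) - 1\<close>, the number \<open>(\<zeta> + \<zeta>\<inverse>)/2\<close> lies in \<open>\<int>[\<xi>]\<close> for a suitable root of
  unity \<open>\<xi>\<close>, so the root of unity \<open>\<omega> = -\<zeta>\<^sup>2\<close> is congruent to \<open>1\<close> modulo \<open>2\<int>[\<xi>]\<close>.
  As \<open>1/2 \<notin> \<int>[\<xi>]\<close>, this forces \<open>\<omega>\<^sup>2 = 1\<close>: if \<open>\<omega>\<^sup>m = 1 \<noteq> \<omega>\<close> with \<open>m\<close> odd, summing the powers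
  of \<open>\<omega>\<close> gives \<open>m \<in> 2\<int>[\<xi>]\<close>, and if \<open>\<omega>\<^sup>2 = -1\<close>, squaring \<open>(1 - \<omega>)/2\<close> gives
  \<open>1/2 \<in> \<int>[\<xi>]\<close>.  Hence \<open>\<zeta>\<^sup>4 = 1\<close>.
\<close>

section \<open>The ring \<open>\<int>[x]\<close> generated by one element\<close>

text \<open>Values at \<open>x\<close> of integer polynomials in Horner form, so that induction
  peels off the constant coefficient.\<close>

inductive_set int_adjoin :: "'a::comm_ring_1 \<Rightarrow> 'a set" for x :: 'a where
  of_int: "of_int a \<in> int_adjoin x"
| step: "y \<in> int_adjoin x \<Longrightarrow> of_int a + x * y \<in> int_adjoin x"

lemma int_adjoin_0: "0 \<in> int_adjoin x"
  using int_adjoin.of_int[of 0] by simp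

lemma int_adjoin_1: "1 \<in> int_adjoin x"
  using int_adjoin.of_int[of 1] by simp

lemma int_adjoin_gen_mult: "y \<in> int_adjoin x \<Longrightarrow> x * y \<in> int_adjoin x"
  using int_adjoin.step[of y x 0] by simp

lemma int_adjoin_gen: "x \<in> int_adjoin x"
  using int_adjoin_gen_mult[OF int_adjoin_1] by simp

lemma int_adjoin_of_int_add:
  assumes "y \<in> int_adjoin x"
  shows "of_int b + y \<in> int_adjoin x"
  using assms
proof cases
  case (of_int a)
  then show ?thesis using int_adjoin.of_int[of "b + a"] by simp
next
  case (step y' a)
  then show ?thesis using int_adjoin.step[of y' x "b + a"] by (simp add: add.assoc)
qed

lemma int_adjoin_add:
  assumes "y \<in> int_adjoin x" "z \<in> int_adjoin x"
  shows "y + z \<in> int_adjoin x"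
  using assms
proof (induction arbitrary: z rule: int_adjoin.induct)
  case (of_int a)
  then show ?case by (rule int_adjoin_of_int_add)
next
  case (step y a)
  from step.prems show ?case
  proof cases
    case (of_int b)
    then show ?thesis using int_adjoin.step[OF step.hyps, of "a + b"] by (simp add: algebra_simps)
  next
    case (step z' b)
    then show ?thesis
      using int_adjoin.step[OF step.IH[OF step(2)], of "a + b"] by (simp add: algebra_simps)
  qed
qed

lemma int_adjoin_of_int_mult:
  assumes "y \<in> int_adjoin x"
  shows "of_int b * y \<in> int_adjoin x"
  using assms
proof (induction rule: int_adjoin.induct)
  case (of_int a)
  then show ?case using int_adjoin.of_int[of "b * a"] by simp
next
  case (step y a)
  then show ?case using int_adjoin.step[of "of_int b * y" x "b * a"] by (simp add: algebra_simps)
qed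

lemma int_adjoin_mult:
  assumes "y \<in> int_adjoin x" "z \<in> int_adjoin x"
  shows "y * z \<in> int_adjoin x"
  using assms
proof (induction rule: int_adjoin.induct)
  case (of_int a)
  then show ?case by (intro int_adjoin_of_int_mult)
next
  case (step y a)
  have "of_int a * z + x * (y * z) \<in> int_adjoin x"
    using step by (intro int_adjoin_add int_adjoin_of_int_mult int_adjoin_gen_mult)
  then show ?case by (simp add: algebra_simps)
qed

lemma int_adjoin_uminus: "y \<in> int_adjoin x \<Longrightarrow> - y \<in> int_adjoin x"
  using int_adjoin_of_int_mult[of y x "-1"] by simp

lemma int_adjoin_diff: "y \<in> int_adjoin x \<Longrightarrow> z \<in> int_adjoin x \<Longrightarrow> y - z \<in> int_adjoin x"
  using int_adjoin_add[of y x "- z"] int_adjoin_uminus[of z x] by simp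

lemma int_adjoin_power: "y \<in> int_adjoin x \<Longrightarrow> y ^ n \<in> int_adjoin x"
  by (induction n) (auto intro: int_adjoin_1 int_adjoin_mult)

lemma int_adjoin_sum:
  "(\<And>i. i \<in> A \<Longrightarrow> f i \<in> int_adjoin x) \<Longrightarrow> sum f A \<in> int_adjoin x"
  by (induction A rule: infinite_finite_induct) (auto intro: int_adjoin_0 int_adjoin_add)

text \<open>Multiplication by \<open>x\<close> permutes the powers of \<open>x\<close> cyclically,
  so finitely many of them span the ring over \<int>. This finiteness is what the elimination
  argument needs.\<close>

lemma int_adjoin_root_of_unity_span:
  fixes x :: "'a::comm_ring_1"
  assumes "y \<in> int_adjoin x" and x: "x ^ Suc n = 1"
  shows "\<exists>c :: nat \<Rightarrow> int. y = (\<Sum>j<Suc n. of_int (c j) * x ^ j)"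
  using assms(1)
proof (induction rule: int_adjoin.induct)
  case (of_int a)
  show ?case
    by (rule exI[of _ "\<lambda>j. if j = 0 then a else 0"])
      (simp add: sum.lessThan_Suc_shift del: sum.lessThan_Suc)
next
  case (step y a)
  then obtain c :: "nat \<Rightarrow> int" where c: "y = (\<Sum>j<Suc n. of_int (c j) * x ^ j)" by blast
  \<comment> \<open>Cyclic shift of \<open>c\<close>: the top coefficient \<open>c n\<close> wraps
    round to the constant term, where \<open>a\<close> is added.\<close>
  define d where "d j = (case j of 0 \<Rightarrow> a + c n | Suc i \<Rightarrow> c i)" for j
  have "x * y = (\<Sum>j<n. of_int (c j) * x ^ Suc j) + of_int (c n) * x ^ Suc n"
    by (simp add: c algebra_simps sum_distrib_left)
  also have "\<dots> = (\<Sum>j<n. of_int (c j) * x ^ Suc j) + of_int (c n)"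
    by (simp only: x mult_1_right)
  finally have "of_int a + x * y = (\<Sum>j<Suc n. of_int (d j) * x ^ j)"
    unfolding sum.lessThan_Suc_shift by (simp add: d_def)
  then show ?case by blast
qed

section \<open>One half is not in the ring\<close>

text \<open>
  A determinant-free Nakayama lemma for the prime \<open>2\<close>, by Gaussian elimination; the odd factors
  \<open>m i\<close> are the denominators cleared on the way.
\<close>

lemma odd_system_trivial:
  fixes e :: "nat \<Rightarrow> 'a::field_char_0" and a :: "nat \<Rightarrow> nat \<Rightarrow> int" and m :: "nat \<Rightarrow> int"
  assumes "\<And>i. i < n \<Longrightarrow> odd (m i)"
    and "\<And>i. i < n \<Longrightarrow> of_int (m i) * e i = 2 * (\<Sum>j<n. of_int (a i j) * e j)"
    and "i < n"
  shows "e i = 0"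
  using assms
proof (induction n arbitrary: m a i)
  case 0
  then show ?case by simp
next
  case (Suc n)
  \<comment> \<open>Coefficient of \<open>e n\<close> once the diagonal term of the last equation is
    moved to the left; it is odd, hence invertible in the field.\<close>
  define q where "q = m n - 2 * a n n"
  have "odd q" using Suc.prems(1)[of n] by (simp add: q_def)
  then have q0: "of_int q \<noteq> (0::'a)" by auto
  have last: "of_int q * e n = 2 * (\<Sum>j<n. of_int (a n j) * e j)"
    using Suc.prems(2)[of n] by (simp add: q_def algebra_simps)
  \<comment> \<open>Equation \<open>i\<close> times \<open>q\<close>, with
    \<open>of_int q * e n\<close> replaced by means of the last equation.\<close>
  define b where "b i j = a i j * q + 2 * a i n * a n j" for i j
  have init: "e i = 0" if "i < n" for i
  proof (rule Suc.IH[of "\<lambda>i. m i * q" b])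
    fix i assume i: "i < n"
    show "odd (m i * q)" using Suc.prems(1)[of i] i \<open>odd q\<close> by simp
    have "of_int (m i * q) * e i = of_int q * (of_int (m i) * e i)"
      by simp
    also have "\<dots> = 2 * (\<Sum>j<n. of_int (a i j * q) * e j) + 2 * of_int (a i n) * (of_int q * e n)"
      using Suc.prems(2)[of i] i by (simp add: algebra_simps sum_distrib_left)
    also have "\<dots> = 2 * (\<Sum>j<n. of_int (b i j) * e j)"
      unfolding last by (simp add: b_def algebra_simps sum_distrib_left sum.distrib)
    finally show "of_int (m i * q) * e i = 2 * (\<Sum>j<n. of_int (b i j) * e j)" .
  qed (use that in auto)
  have "e n = 0" using last q0 init by simp
  then show ?case using init Suc.prems(3) less_Suc_eq by auto
qed

text \<open>Otherwise each power of \<open>x\<close> would be twice an integer combination of powers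
  of \<open>x\<close>, and elimination would make all of them vanish, including
  \<open>x ^ 0\<close>.\<close>

lemma half_notin_int_adjoin:
  fixes x :: "'a::field_char_0"
  assumes "n > 0" "x ^ n = 1"
  shows "1 / 2 \<notin> int_adjoin x"
proof
  assume half: "1 / 2 \<in> int_adjoin x"
  obtain k where n: "n = Suc k" using assms(1) gr0_implies_Suc by blast
  have "\<exists>c :: nat \<Rightarrow> int. 1 / 2 * x ^ i = (\<Sum>j<n. of_int (c j) * x ^ j)" for i
    using int_adjoin_root_of_unity_span[of "1 / 2 * x ^ i" x k] assms(2) half
    by (auto simp only: n intro: int_adjoin_mult int_adjoin_power int_adjoin_gen)
  then obtain a :: "nat \<Rightarrow> nat \<Rightarrow> int"
    where a: "\<And>i. 1 / 2 * x ^ i = (\<Sum>j<n. of_int (a i j) * x ^ j)" by metis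
  have "x ^ 0 = 0"
    by (rule odd_system_trivial[of n "\<lambda>_. 1" "\<lambda>i. x ^ i" a])
      (use assms(1) in \<open>auto simp flip: a\<close>)
  then show False by simp
qed

lemma odd_half_imp_half_int_adjoin:
  fixes x :: "'a::field_char_0"
  assumes "odd m" "of_nat m / 2 \<in> int_adjoin x"
  shows "1 / 2 \<in> int_adjoin x"
proof -
  obtain k where m: "m = 2 * k + 1" using assms(1) oddE by blast
  have "of_nat m / 2 - of_int (int k) \<in> int_adjoin x"
    using assms(2) by (intro int_adjoin_diff int_adjoin.of_int)
  then show ?thesis by (simp add: m add_divide_distrib)
qed

section \<open>Roots of unity congruent to 1 modulo 2\<close>

text \<open>Membership of \<open>(1 - w) / 2\<close> encodes that \<open>w\<close> is congruent to 1
  modulo \<open>2\<int>[x]\<close>.\<close>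

lemma cong_1_mod_2_mult:
  fixes x :: "'a::field_char_0"
  assumes "(1 - v) / 2 \<in> int_adjoin x" "(1 - w) / 2 \<in> int_adjoin x"
  shows "(1 - v * w) / 2 \<in> int_adjoin x"
proof -
  let ?p = "(1 - v) / 2" and ?q = "(1 - w) / 2"
  have "?p + ?q - of_int 2 * (?p * ?q) \<in> int_adjoin x"
    using assms
    by (intro int_adjoin_diff int_adjoin_add int_adjoin_of_int_mult int_adjoin_mult)
  moreover have "?p + ?q - of_int 2 * (?p * ?q) = (1 - v * w) / 2"
    by (simp add: field_simps)
  ultimately show ?thesis by (simp only:)
qed

lemma cong_1_mod_2_power:
  fixes x :: "'a::field_char_0"
  assumes "(1 - w) / 2 \<in> int_adjoin x"
  shows "(1 - w ^ n) / 2 \<in> int_adjoin x"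
  by (induction n) (auto intro: int_adjoin_0 cong_1_mod_2_mult[OF assms])

lemma cong_1_mod_2_odd_root_of_unity:
  fixes x :: "'a::field_char_0"
  assumes half: "1 / 2 \<notin> int_adjoin x" and w: "(1 - w) / 2 \<in> int_adjoin x"
    and "odd m" "w ^ m = 1"
  shows "w = 1"
proof (rule ccontr)
  assume "w \<noteq> 1"
  have "(1 - w) * (\<Sum>i<m. w ^ i) = 0"
    using one_diff_power_eq[of w m] assms(4) by simp
  with \<open>w \<noteq> 1\<close> have "(\<Sum>i<m. w ^ i) = 0" by simp
  then have "(\<Sum>i<m. (1 - w ^ i) / 2) = of_nat m / 2"
    by (simp add: sum_subtractf flip: sum_divide_distrib)
  moreover have "(\<Sum>i<m. (1 - w ^ i) / 2) \<in> int_adjoin x"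
    using w by (intro int_adjoin_sum cong_1_mod_2_power)
  ultimately show False using odd_half_imp_half_int_adjoin half \<open>odd m\<close> by metis
qed

text \<open>The value \<open>w = -1\<close> does satisfy the congruence, so \<open>w = 1\<close>
  cannot be concluded.\<close>

lemma cong_1_mod_2_two_power_root_of_unity:
  fixes x :: "'a::field_char_0"
  assumes half: "1 / 2 \<notin> int_adjoin x"
    and "(1 - w) / 2 \<in> int_adjoin x" "w ^ (2 ^ k) = 1"
  shows "w\<^sup>2 = 1"
  using assms(2,3)
proof (induction k arbitrary: w)
  case 0
  then show ?case by simp
next
  case (Suc k)
  let ?b = "(1 - w) / 2"
  \<comment> \<open>The induction hypothesis is applied to the square of \<open>w\<close>, leaving
    only primitive fourth roots of unity to exclude.\<close>
  have "(w\<^sup>2)\<^sup>2 = 1"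
    using Suc.prems by (intro Suc.IH cong_1_mod_2_power) (simp_all flip: power_mult)
  then consider "w\<^sup>2 = 1" | "w\<^sup>2 = - 1" using power2_eq_1_iff by blast
  then show ?case
  proof cases
    case 2
    have "1 - of_int 2 * ?b \<in> int_adjoin x"
      using Suc.prems(1) by (intro int_adjoin_diff int_adjoin_of_int_mult int_adjoin_1)
    moreover have "1 - of_int 2 * ?b = w" by (simp add: field_simps)
    ultimately have "w \<in> int_adjoin x" by (simp only:)
    then have "?b\<^sup>2 * w \<in> int_adjoin x"
      using Suc.prems(1) by (intro int_adjoin_mult int_adjoin_power)
    moreover have "?b\<^sup>2 = - w / 2"
      using 2 by (simp add: power2_diff power_divide)
    then have "?b\<^sup>2 * w = - (w\<^sup>2) / 2"
      by (simp add: power2_eq_square)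
    then have "?b\<^sup>2 * w = 1 / 2" using 2 by simp
    ultimately have "1 / 2 \<in> int_adjoin x" by simp
    with half show ?thesis by simp
  qed
qed

lemma nat_two_power_odd_decomp:
  fixes n :: nat
  assumes "n > 0"
  shows "\<exists>k m. n = 2 ^ k * m \<and> odd m"
  using assms
proof (induction n rule: less_induct)
  case (less n)
  show ?case
  proof (cases "odd n")
    case True
    then show ?thesis by (intro exI[of _ 0] exI[of _ n]) simp
  next
    case False
    then obtain n' where n': "n = 2 * n'" by (blast elim: evenE)
    then obtain k m where "n' = 2 ^ k * m" "odd m" using less.IH[of n'] less.prems by auto
    then show ?thesis by (intro exI[of _ "Suc k"] exI[of _ m]) (simp add: n')
  qed
qed

text \<open>For \<open>n = 2 ^ k * m\<close> with \<open>m\<close> odd, the odd case applied to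
  \<open>w ^ (2 ^ k)\<close> reduces to the two-power case.\<close>

lemma cong_1_mod_2_root_of_unity:
  fixes x :: "'a::field_char_0"
  assumes half: "1 / 2 \<notin> int_adjoin x" and w: "(1 - w) / 2 \<in> int_adjoin x"
    and "n > 0" "w ^ n = 1"
  shows "w\<^sup>2 = 1"
proof -
  obtain k m where n: "n = 2 ^ k * m" and "odd m"
    using \<open>n > 0\<close> nat_two_power_odd_decomp by blast
  have "(w ^ (2 ^ k)) ^ m = 1"
    using assms(4) by (simp only: n power_mult)
  then have "w ^ (2 ^ k) = 1"
    by (rule cong_1_mod_2_odd_root_of_unity[OF half cong_1_mod_2_power[OF w] \<open>odd m\<close>])
  then show ?thesis using cong_1_mod_2_two_power_root_of_unity[OF half w] by simp
qed

section \<open>From angles to roots of unity\<close>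

lemma cis_int_multiple_in_int_adjoin:
  assumes "n > 0"
  shows "cis (2 * pi * of_int a / of_nat n) \<in> int_adjoin (cis (2 * pi / of_nat n))"
proof -
  \<comment> \<open>Reduction modulo \<open>n\<close> turns a possibly negative exponent into a
    natural one, as only such powers lie in the ring by construction.\<close>
  define b where "b = nat (a mod int n)"
  have "a = a div int n * int n + int b"
    using assms by (simp add: b_def)
  then have "real_of_int a = of_int (a div int n) * of_nat n + of_nat b"
    by (metis of_int_add of_int_mult of_int_of_nat_eq)
  then have "2 * pi * of_int a / of_nat n =
      2 * pi * of_int (a div int n) + of_nat b * (2 * pi / of_nat n)"
    using assms by (simp add: field_simps)
  then have "cis (2 * pi * of_int a / of_nat n) = cis (2 * pi / of_nat n) ^ b"
    by (simp add: DeMoivre flip: cis_mult)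
  then show ?thesis by (simp add: int_adjoin_power int_adjoin_gen)
qed

lemma rational_multiple_of_pi_int_frac:
  assumes "rational_multiple_of_pi \<theta>"
  obtains a :: int and n :: nat where "n > 0" "\<theta> = 2 * pi * of_int a / of_nat n"
proof -
  from assms obtain r where "r \<in> \<rat>" and \<theta>: "\<theta> = r * pi"
    by (auto simp: rational_multiple_of_pi_def)
  from \<open>r \<in> \<rat>\<close> obtain p q :: int where "q > 0" "r = of_int p / of_int q"
    by (auto elim: Rats_cases')
  then show ?thesis
    using that[of "nat (2 * q)" p] \<theta> by simp
qed

text \<open>Applied with \<open>\<alpha> = \<gamma> / 2\<close>; the integer \<open>s\<close>
  carries the sign in the hypothesis on \<open>\<gamma>\<close>.\<close>

lemma half_angle_relation_imp_quarter_turn: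
  assumes "rational_multiple_of_pi \<phi>" "rational_multiple_of_pi \<alpha>"
    and cos_eq: "cos \<phi> = of_int s * (2 * cos \<alpha>) - 1"
  shows "cis \<phi> ^ 4 = 1"
proof -
  obtain a m where m: "m > 0" and \<phi>: "\<phi> = 2 * pi * of_int a / of_nat m"
    using rational_multiple_of_pi_int_frac assms(1) by blast
  obtain b l where l: "l > 0" and \<alpha>: "\<alpha> = 2 * pi * of_int b / of_nat l"
    using rational_multiple_of_pi_int_frac assms(2) by blast
  \<comment> \<open>A common denominator makes all the roots of unity involved powers of a single
    \<open>x\<close>.\<close>
  define n where "n = m * l"
  have n: "n > 0" using m l by (simp add: n_def)
  define x where "x = cis (2 * pi / of_nat n)"
  have \<phi>': "\<phi> = 2 * pi * of_int (a * int l) / of_nat n"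
    and \<alpha>': "\<alpha> = 2 * pi * of_int (b * int m) / of_nat n"
    using m l by (simp_all add: \<phi> \<alpha> n_def)
  have minus: "- (2 * pi * of_int c / of_nat n) = 2 * pi * of_int (- c) / of_nat n" for c
    by simp
  have in_R: "cis \<phi> \<in> int_adjoin x" "cis \<alpha> \<in> int_adjoin x" "cis (- \<alpha>) \<in> int_adjoin x"
    unfolding \<phi>' \<alpha>' minus x_def by (rule cis_int_multiple_in_int_adjoin[OF n])+
  have double_cos: "complex_of_real (2 * cos t) = cis t + cis (- t)" for t
    by (simp add: complex_eq_iff)
  have "complex_of_real (cos \<phi>) = of_int s * (cis \<alpha> + cis (- \<alpha>)) - 1"
    unfolding cos_eq double_cos[symmetric] by simp
  also have "\<dots> \<in> int_adjoin x"
    by (intro int_adjoin_diff int_adjoin_of_int_mult int_adjoin_add int_adjoin_1 in_R)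
  finally have "cis \<phi> * of_real (cos \<phi>) \<in> int_adjoin x"
    using in_R(1) by (rule int_adjoin_mult[rotated])
  moreover have "cis \<phi> * of_real (cos \<phi>) = (1 - - (cis \<phi>)\<^sup>2) / 2"
  proof -
    have "2 * (cis \<phi> * of_real (cos \<phi>)) = cis \<phi> * (cis \<phi> + cis (- \<phi>))"
      unfolding double_cos[symmetric] by simp
    also have "\<dots> = (cis \<phi>)\<^sup>2 + 1" by (simp add: algebra_simps power2_eq_square cis_mult)
    finally show ?thesis by (simp add: field_simps)
  qed
  ultimately have cong: "(1 - - (cis \<phi>)\<^sup>2) / 2 \<in> int_adjoin x" by simp
  have "x ^ n = 1"
    using n by (simp add: x_def DeMoivre)
  then have half: "1 / 2 \<notin> int_adjoin x" by (rule half_notin_int_adjoin[OF n])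
  have "cis \<phi> ^ n = 1"
    using n cis_multiple_2pi[of "of_int (a * int l)"] by (simp add: \<phi>' DeMoivre mult_ac)
  \<comment> \<open>The even exponent absorbs the minus sign, whatever the parity of
    \<open>n\<close>.\<close>
  have "(- (cis \<phi>)\<^sup>2) ^ (2 * n) = ((cis \<phi>)\<^sup>2) ^ (2 * n)"
    by simp
  also have "\<dots> = (cis \<phi> ^ n) ^ 4"
    unfolding power_mult[symmetric] by (rule arg_cong[where f = "power (cis \<phi>)"]) simp
  also have "\<dots> = 1" using \<open>cis \<phi> ^ n = 1\<close> by simp
  finally have "(- (cis \<phi>)\<^sup>2) ^ (2 * n) = 1" .
  then have "(- (cis \<phi>)\<^sup>2)\<^sup>2 = 1"
    by (intro cong_1_mod_2_root_of_unity[OF half cong, of "2 * n"]) (use n in simp_all)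
  then show ?thesis by (simp flip: power_mult)
qed

theorem theorem1:
  fixes \<phi> \<gamma> :: real
  assumes "rational_multiple_of_pi \<phi>"
    and "cos (\<gamma> / 2) = (cos (\<phi> / 2))\<^sup>2 \<or> - cos (\<gamma> / 2) = (cos (\<phi> / 2))\<^sup>2"
  shows "rational_multiple_of_pi \<gamma> \<longleftrightarrow> \<phi> \<in> {of_int k * pi / 2 | k :: int. True}"
proof
  have cos_\<phi>: "cos \<phi> = 2 * (cos (\<phi> / 2))\<^sup>2 - 1"
    using cos_double_cos[of "\<phi> / 2"] by simp
  {
    assume "rational_multiple_of_pi \<gamma>"
    then obtain r where "r \<in> \<rat>" "\<gamma> = r * pi"
      by (auto simp: rational_multiple_of_pi_def)
    then have half_\<gamma>: "rational_multiple_of_pi (\<gamma> / 2)"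
      unfolding rational_multiple_of_pi_def by (intro bexI[of _ "r / 2"]) auto
    obtain s :: int where "cos \<phi> = of_int s * (2 * cos (\<gamma> / 2)) - 1"
      using assms(2) cos_\<phi> that[of 1] that[of "-1"] by auto
    then have "cis (4 * \<phi>) = 1"
      using half_angle_relation_imp_quarter_turn[OF assms(1) half_\<gamma>, of s] unfolding DeMoivre by simp
    then have "cos (4 * \<phi>) = 1" by (simp add: complex_eq_iff)
    then obtain k :: int where "4 * \<phi> = of_int k * 2 * pi"
      by (auto simp: cos_one_2pi_int)
    then have "\<phi> = of_int k * pi / 2" by (simp add: mult.commute)
    then show "\<phi> \<in> {of_int k * pi / 2 | k :: int. True}" by blast
  }
  {
    assume "\<phi> \<in> {of_int k * pi / 2 | k :: int. True}"
    then obtain k :: int where "\<phi> = of_int k * pi / 2" by blast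
    then have "2 * \<phi> = of_int k * pi" by simp
    then have "sin (2 * \<phi>) = 0" using sin_zero_iff_int2 by blast
    then have "sin \<phi> * cos \<phi> = 0" by (simp add: sin_double)
    then have "cos \<phi> = 0 \<or> (cos \<phi>)\<^sup>2 = 1"
      using sin_squared_eq[of \<phi>] by auto
    then have "cos \<phi> = 0 \<or> cos \<phi> = 1 \<or> cos \<phi> = - 1" using power2_eq_1_iff by blast
    moreover define c where "c = (cos (\<phi> / 2))\<^sup>2"
    ultimately have "c \<in> {0, 1 / 2, 1}" using cos_\<phi> by auto
    \<comment> \<open>Squaring merges the two signs allowed by the hypothesis.\<close>
    moreover have "(cos (\<gamma> / 2))\<^sup>2 = c\<^sup>2"
      using assms(2) unfolding c_def by (metis power2_minus)
    then have "cos \<gamma> = 2 * c\<^sup>2 - 1"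
      using cos_double_cos[of "\<gamma> / 2"] by simp
    ultimately have "cos \<gamma> \<in> {1, - 1 / 2, - 1}"
      by (elim insertE emptyE) (simp_all add: power2_eq_square)
    then have "sin \<gamma> = 0 \<or> 4 * (cos \<gamma>)\<^sup>2 = 1"
      using sin_squared_eq[of \<gamma>] by (elim insertE emptyE) (simp_all add: power2_eq_square)
    \<comment> \<open>The factors vanish for \<open>cos \<gamma>\<close> equal to 1 or -1 and to
      -1/2 respectively, so tripling the angle treats all cases at once.\<close>
    moreover have "sin (3 * \<gamma>) = sin \<gamma> * (4 * (cos \<gamma>)\<^sup>2 - 1)"
    proof -
      have "sin (3 * \<gamma>) = sin (2 * \<gamma> + \<gamma>)" by simp
      also have "\<dots> = sin \<gamma> * (4 * (cos \<gamma>)\<^sup>2 - 1)"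
        unfolding sin_add sin_double cos_double_cos by (simp add: algebra_simps power2_eq_square)
      finally show ?thesis .
    qed
    ultimately have "sin (3 * \<gamma>) = 0" by auto
    then obtain j :: int where "3 * \<gamma> = of_int j * pi" by (auto simp: sin_zero_iff_int2)
    then have "\<gamma> = of_int j / of_int 3 * pi" by simp
    then show "rational_multiple_of_pi \<gamma>"
      unfolding rational_multiple_of_pi_def by (intro bexI[of _ "of_int j / of_int 3"]) auto
  }
qed

end
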